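(* For every integer $n\ge 2$, the semigroup $\mathcal{SS}'_n$ is not left abundant.
   Context: Let $[n]=\{1,2,\dots,n\}$ with its usual order. $\mathcal{P}_n$ is the semigroup of all partial transformations of $[n]$ (maps whose domain and image are subsets of $[n]$, including the empty map), composed from left to right: $x(\alpha\beta)=(x\alpha)\beta$. A partial map $\alpha$ is isotone if $x\le y$ implies $x\alpha\le y\alpha$ for all $x,y\in\mathrm{Dom}\,\alpha$, and order-decreasing if $x\alpha\le x$ for all $x\in\mathrm{Dom}\,\alpha$. $\mathcal{LS}_n$ is the monoid of all isotone order-decreasing $\alpha\in\mathcal{P}_n$, and $\mathcal{SS}'_n=\{\alpha\in\mathcal{LS}_n: 1\notin \mathrm{Dom}\,\alpha\}$, a subsemigroup of $\mathcal{LS}_n$. For a semigroup $S$, $S^1$ is $S$ with an identity adjoined if necessary, and $\mathcal{L}^*$ is the relation on $S$ given by $(a,b)\in\mathcal{L}^*$ if and only if for all $x,y\in S^1$: $ax=ay\iff bx=by$. $S$ is left abundant if every $\mathcal{L}^*$-class of $S$ contains an idempotent. *)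

theory Defs
  imports Main
begin

definition semigroup_on :: "'a set \<Rightarrow> ('a \<Rightarrow> 'a \<Rightarrow> 'a) \<Rightarrow> bool" where
  "semigroup_on S m \<longleftrightarrow>
     (\<forall>a\<in>S. \<forall>b\<in>S. m a b \<in> S) \<and>
     (\<forall>a\<in>S. \<forall>b\<in>S. \<forall>c\<in>S. m (m a b) c = m a (m b c))"

definition is_identity :: "'a set \<Rightarrow> ('a \<Rightarrow> 'a \<Rightarrow> 'a) \<Rightarrow> 'a \<Rightarrow> bool" where
  "is_identity S m e \<longleftrightarrow> e \<in> S \<and> (\<forall>a\<in>S. m e a = a \<and> m a e = a)"

text \<open>The semigroup with an identity adjoined if necessary lives on the option type: an element
  \<open>a\<close> of \<open>S\<close> is represented by \<open>Some a\<close>, and \<open>None\<close> is the new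
  identity, which is present only if \<open>S\<close> has no identity of its own.\<close>

definition adjoin_one :: "'a set \<Rightarrow> ('a \<Rightarrow> 'a \<Rightarrow> 'a) \<Rightarrow> 'a option set" where
  "adjoin_one S m =
     (if \<exists>e. is_identity S m e then Some ` S else insert None (Some ` S))"

fun mult_one :: "('a \<Rightarrow> 'a \<Rightarrow> 'a) \<Rightarrow> 'a option \<Rightarrow> 'a option \<Rightarrow> 'a option" where
  "mult_one m None y = y"
| "mult_one m (Some a) None = Some a"
| "mult_one m (Some a) (Some b) = Some (m a b)"

definition Lstar :: "'a set \<Rightarrow> ('a \<Rightarrow> 'a \<Rightarrow> 'a) \<Rightarrow> ('a \<times> 'a) set" where
  "Lstar S m = {(a, b). a \<in> S \<and> b \<in> S \<and>
     (\<forall>x\<in>adjoin_one S m. \<forall>y\<in>adjoin_one S m.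
        mult_one m (Some a) x = mult_one m (Some a) y \<longleftrightarrow>
        mult_one m (Some b) x = mult_one m (Some b) y)}"

definition left_abundant :: "'a set \<Rightarrow> ('a \<Rightarrow> 'a \<Rightarrow> 'a) \<Rightarrow> bool" where
  "left_abundant S m \<longleftrightarrow> (\<forall>C \<in> S // Lstar S m. \<exists>e\<in>C. m e e = e)"

lemma equiv_Lstar: "equiv S (Lstar S m)"
proof (rule equivI)
  show "Lstar S m \<subseteq> S \<times> S" unfolding Lstar_def by blast
  show "refl_on S (Lstar S m)" unfolding Lstar_def refl_on_def by blast
  show "sym (Lstar S m)" unfolding Lstar_def by (rule symI) simp
  show "trans (Lstar S m)" unfolding Lstar_def by (rule transI) simp
qed

definition partial_transformations :: "nat \<Rightarrow> (nat \<rightharpoonup> nat) set" where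
  "partial_transformations n = {\<alpha>. dom \<alpha> \<subseteq> {1..n} \<and> ran \<alpha> \<subseteq> {1..n}}"

text \<open>Maps are composed from left to right.\<close>

definition lr_comp :: "(nat \<rightharpoonup> nat) \<Rightarrow> (nat \<rightharpoonup> nat) \<Rightarrow> (nat \<rightharpoonup> nat)" where
  "lr_comp \<alpha> \<beta> = \<beta> \<circ>\<^sub>m \<alpha>"

definition isotone :: "(nat \<rightharpoonup> nat) \<Rightarrow> bool" where
  "isotone \<alpha> \<longleftrightarrow> (\<forall>x\<in>dom \<alpha>. \<forall>y\<in>dom \<alpha>. x \<le> y \<longrightarrow> the (\<alpha> x) \<le> the (\<alpha> y))"

definition order_decreasing :: "(nat \<rightharpoonup> nat) \<Rightarrow> bool" where
  "order_decreasing \<alpha> \<longleftrightarrow> (\<forall>x\<in>dom \<alpha>. the (\<alpha> x) \<le> x)"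

definition LS :: "nat \<Rightarrow> (nat \<rightharpoonup> nat) set" where
  "LS n = {\<alpha> \<in> partial_transformations n. isotone \<alpha> \<and> order_decreasing \<alpha>}"

definition SS' :: "nat \<Rightarrow> (nat \<rightharpoonup> nat) set" where
  "SS' n = {\<alpha> \<in> LS n. 1 \<notin> dom \<alpha>}"

lemma lr_comp_assoc: "lr_comp (lr_comp \<alpha> \<beta>) \<gamma> = lr_comp \<alpha> (lr_comp \<beta> \<gamma>)"
  by (auto simp: lr_comp_def map_comp_def split: option.splits)

lemma LS_closed:
  assumes "\<alpha> \<in> LS n" "\<beta> \<in> LS n"
  shows "lr_comp \<alpha> \<beta> \<in> LS n"
proof -
  have P: "dom \<alpha> \<subseteq> {1..n}" "ran \<beta> \<subseteq> {1..n}"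
    and i: "isotone \<alpha>" "isotone \<beta>" and d: "order_decreasing \<alpha>" "order_decreasing \<beta>"
    using assms by (auto simp: LS_def partial_transformations_def)
  have "dom (lr_comp \<alpha> \<beta>) \<subseteq> dom \<alpha>" "ran (lr_comp \<alpha> \<beta>) \<subseteq> ran \<beta>"
    by (auto simp: lr_comp_def map_comp_Some_iff ran_def)
  moreover have "isotone (lr_comp \<alpha> \<beta>)"
    unfolding isotone_def
  proof (intro ballI impI)
    fix x y assume "x \<in> dom (lr_comp \<alpha> \<beta>)" "y \<in> dom (lr_comp \<alpha> \<beta>)" and le: "x \<le> y"
    then obtain u v u' v' where e: "\<alpha> x = Some u" "\<beta> u = Some u'" "\<alpha> y = Some v" "\<beta> v = Some v'"
      by (auto simp: lr_comp_def map_comp_Some_iff)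
    have "u \<le> v"
      using i(1)[unfolded isotone_def, THEN bspec, of x, THEN bspec, of y] e le by (simp add: domI)
    then have "u' \<le> v'"
      using i(2)[unfolded isotone_def, THEN bspec, of u, THEN bspec, of v] e by (simp add: domI)
    then show "the (lr_comp \<alpha> \<beta> x) \<le> the (lr_comp \<alpha> \<beta> y)"
      using e by (simp add: lr_comp_def)
  qed
  moreover have "order_decreasing (lr_comp \<alpha> \<beta>)"
    unfolding order_decreasing_def
  proof
    fix x assume "x \<in> dom (lr_comp \<alpha> \<beta>)"
    then obtain u u' where e: "\<alpha> x = Some u" "\<beta> u = Some u'"
      by (auto simp: lr_comp_def map_comp_Some_iff)
    have "u \<le> x"
      using d(1)[unfolded order_decreasing_def, THEN bspec, of x] e by (simp add: domI)
    moreover have "u' \<le> u"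
      using d(2)[unfolded order_decreasing_def, THEN bspec, of u] e by (simp add: domI)
    ultimately show "the (lr_comp \<alpha> \<beta> x) \<le> x"
      using e by (simp add: lr_comp_def)
  qed
  ultimately show ?thesis using P
    unfolding LS_def partial_transformations_def by blast
qed

lemma semigroup_on_SS': "semigroup_on (SS' n) lr_comp"
proof -
  have "lr_comp \<alpha> \<beta> \<in> SS' n" if "\<alpha> \<in> SS' n" "\<beta> \<in> SS' n" for \<alpha> \<beta>
    using that LS_closed[of \<alpha> n \<beta>]
    by (auto simp: SS'_def lr_comp_def map_comp_Some_iff dom_def)
  then show ?thesis by (auto simp: semigroup_on_def lr_comp_assoc)
qed

end

theory Submission
  imports Defs
begin

text \<open>No element of \<open>SS' n\<close> is defined at \<open>1\<close>, so the map \<open>\<alpha>\<close> with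
  \<open>2 \<mapsto> 1\<close> and no other values is annihilated by every right multiplication. In particular
  \<open>SS' n\<close> has no identity, so a new one is adjoined. An idempotent \<open>e\<close> satisfies \<open>e e = e 1\<close>;
  if it were related to \<open>\<alpha>\<close>, then \<open>\<alpha> e = \<alpha> 1 = \<alpha>\<close>, which is impossible because \<open>\<alpha>\<close> is
  not empty.\<close>

lemma lr_comp_to_one_neq:
  assumes "\<beta> \<in> SS' n"
  shows "lr_comp [2 \<mapsto> 1] \<beta> \<noteq> [2 \<mapsto> 1]"
proof
  assume "lr_comp [2 \<mapsto> 1] \<beta> = [2 \<mapsto> 1]"
  \<comment> \<open>At \<open>2\<close> the product takes the value \<open>\<beta> 1\<close>, which
    is \<open>None\<close> since \<open>1\<close> lies outside \<open>dom \<beta>\<close>.\<close>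
  then have "lr_comp [2 \<mapsto> 1] \<beta> 2 = Some 1" by simp
  with assms show False by (auto simp: lr_comp_def SS'_def)
qed

text \<open>The bound on \<open>n\<close> puts \<open>2\<close> into \<open>{1..n}\<close>;
  isotonicity is trivial on a one-point domain.\<close>

lemma to_one_in_SS':
  assumes "n \<ge> 2"
  shows "[2 \<mapsto> 1] \<in> SS' n"
  using assms
  by (auto simp: SS'_def LS_def partial_transformations_def isotone_def order_decreasing_def)

theorem lemma2p14:
  fixes n :: nat
  assumes "n \<ge> 2"
  shows "\<not> left_abundant (SS' n) lr_comp"
proof
  let ?\<alpha> = "[2 \<mapsto> 1] :: nat \<rightharpoonup> nat"
  let ?L = "Lstar (SS' n) lr_comp"
  assume "left_abundant (SS' n) lr_comp"
  moreover have in_SS': "?\<alpha> \<in> SS' n" using assms by (rule to_one_in_SS')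
  ultimately obtain e where e: "(?\<alpha>, e) \<in> ?L" "lr_comp e e = e"
    by (auto simp: left_abundant_def dest!: bspec[OF _ quotientI])
  \<comment> \<open>An identity \<open>u\<close> would give
    \<open>lr_comp ?\<alpha> u = ?\<alpha>\<close>.\<close>
  have "\<nexists>u. is_identity (SS' n) lr_comp u"
    using in_SS' lr_comp_to_one_neq by (auto simp: is_identity_def)
  moreover have "e \<in> SS' n" using e(1) by (simp add: Lstar_def)
  ultimately have "Some e \<in> adjoin_one (SS' n) lr_comp" "None \<in> adjoin_one (SS' n) lr_comp"
    by (simp_all add: adjoin_one_def)
  \<comment> \<open>The \<open>Lstar\<close> condition at \<open>x = Some e\<close>,
    \<open>y = None\<close>: its right-hand equation is the idempotency of \<open>e\<close>.\<close>
  then have "mult_one lr_comp (Some ?\<alpha>) (Some e) = mult_one lr_comp (Some ?\<alpha>) None \<longleftrightarrow>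
      mult_one lr_comp (Some e) (Some e) = mult_one lr_comp (Some e) None"
    using e(1) unfolding Lstar_def by blast
  with e(2) have "lr_comp ?\<alpha> e = ?\<alpha>" by simp
  with lr_comp_to_one_neq[OF \<open>e \<in> SS' n\<close>] show False by contradiction
qed

end
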